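(* Let $S_t=S_0\exp(X_t)$, where $X$ is a Meixner process with $X_0=0$ (as described in the context). Suppose that for each $t$ there are $p>1$ and $p'>0$ such that $S_t^{p}$ and $S_t^{-p'}$ are integrable. Let $h$ be a function on $]0,\infty[$ of at most linear growth such that $h(S_T)$ is integrable for each $T>0$. Then, for each $T>0$, $\mathbf{E}[h(S_T)\mid S_0=x]$ is a $C^1$-smooth function of $x\in\,]0,\infty[$.
   Context: The process $X$ is a Lévy process with $X_0=0$; the interest rate is zero and $S$ is given under risk-neutral dynamics (so $S$ is a martingale). Being a Meixner process means that there are parameters $\alpha>0$, $-\pi<\beta<\pi$, $\mu\in\mathbb{R}$, $\delta>0$ such that, for each $t>0$, $X_t$ follows the Meixner distribution $\mathrm{Meix}(\alpha,\beta,\mu t,\delta t)$, i.e. has the density $$f_t(x)=\frac{(2\cos(\beta/2))^{2\delta t}}{2\pi\alpha\,\Gamma(2\delta t)}\,e^{\frac{\beta}{\alpha}(x-\mu t)}\left|\Gamma\!\left(\delta t+i\,\frac{x-\mu t}{\alpha}\right)\right|^2,\qquad x\in\mathbb{R}.$$ (In particular $X_t$ has a continuous density with support $\mathbb{R}$.) The function $h$ is Borel measurable and real valued; at most linear growth means $|h(x)|\le c(1+x)$ for some $c>0$. For $x>0$, $\mathbf{E}[h(S_T)\mid S_0=x]=\mathbf{E}[h(xe^{X_T})]$. *)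

theory Defs
  imports "HOL-Probability.Probability"
begin

text \<open>
  Processes are functions \<open>X :: real \<Rightarrow> 'a \<Rightarrow> real\<close>, time first; only times \<open>t \<ge> 0\<close> matter.
  No path regularity beyond stochastic continuity is required of a Levy process, so the
  processes with right-continuous paths having left limits are included.
\<close>

locale levy_process = prob_space M for M :: "'a measure" +
  fixes X :: "real \<Rightarrow> 'a \<Rightarrow> real"
  assumes measurable_X: "\<And>t. 0 \<le> t \<Longrightarrow> X t \<in> borel_measurable M"
    and start_zero: "AE \<omega> in M. X 0 \<omega> = 0"
    and independent_increments:
      "\<And>(n::nat) (\<tau>::nat \<Rightarrow> real). 0 \<le> \<tau> 0 \<Longrightarrow> mono_on {..n} \<tau> \<Longrightarrow>
         indep_vars (\<lambda>_. borel) (\<lambda>i \<omega>. X (\<tau> (Suc i)) \<omega> - X (\<tau> i) \<omega>) {..<n}"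
    and stationary_increments:
      "\<And>s t. 0 \<le> s \<Longrightarrow> 0 \<le> t \<Longrightarrow>
         distr M borel (\<lambda>\<omega>. X (s + t) \<omega> - X s \<omega>) = distr M borel (X t)"
    and stochastically_continuous:
      "\<And>t \<epsilon>. 0 \<le> t \<Longrightarrow> 0 < \<epsilon> \<Longrightarrow>
         ((\<lambda>s. prob {\<omega> \<in> space M. \<bar>X s \<omega> - X t \<omega>\<bar> > \<epsilon>}) \<longlongrightarrow> 0) (at t within {0..})"

definition meixner_density :: "real \<Rightarrow> real \<Rightarrow> real \<Rightarrow> real \<Rightarrow> real \<Rightarrow> real" where
  "meixner_density \<alpha> \<beta> \<mu> \<delta> x =
     (2 * cos (\<beta> / 2)) powr (2 * \<delta>) / (2 * pi * \<alpha> * Gamma (2 * \<delta>))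
       * exp (\<beta> / \<alpha> * (x - \<mu>))
       * (cmod (Gamma (complex_of_real \<delta> + \<i> * complex_of_real ((x - \<mu>) / \<alpha>))))\<^sup>2"

definition meixner_process :: "'a measure \<Rightarrow> (real \<Rightarrow> 'a \<Rightarrow> real) \<Rightarrow> bool" where
  "meixner_process M X \<longleftrightarrow>
     levy_process M X \<and>
     (\<exists>\<alpha> \<beta> \<mu> \<delta>. \<alpha> > 0 \<and> - pi < \<beta> \<and> \<beta> < pi \<and> \<delta> > 0 \<and>
        (\<forall>t>0. distributed M lborel (X t)
                 (\<lambda>x. ennreal (meixner_density \<alpha> \<beta> (\<mu> * t) (\<delta> * t) x))))"

definition generated_sigma ::
    "'a measure \<Rightarrow> (real \<Rightarrow> 'a \<Rightarrow> real) \<Rightarrow> real set \<Rightarrow> 'a measure" where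
  "generated_sigma M Y I =
     sigma (space M) (\<Union>t\<in>I. {Y t -` B \<inter> space M | B. B \<in> sets borel})"

definition natural_filtration ::
    "'a measure \<Rightarrow> (real \<Rightarrow> 'a \<Rightarrow> real) \<Rightarrow> real \<Rightarrow> 'a measure" where
  "natural_filtration M Y t = generated_sigma M Y {0..t}"

definition martingale ::
    "'a measure \<Rightarrow> (real \<Rightarrow> 'a measure) \<Rightarrow> (real \<Rightarrow> 'a \<Rightarrow> real) \<Rightarrow> bool" where
  "martingale M F Y \<longleftrightarrow>
     filtration (space M) F \<and> (\<forall>t. subalgebra M (F t)) \<and>
     (\<forall>t\<ge>0. Y t \<in> borel_measurable (F t) \<and> integrable M (Y t)) \<and>
     (\<forall>s t. 0 \<le> s \<and> s \<le> t \<longrightarrow> (AE \<omega> in M. real_cond_exp M (F s) (Y t) \<omega> = Y s \<omega>))"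

lemma sets_generated_sigma:
  "sets (generated_sigma M Y I) =
     sigma_sets (space M) (\<Union>t\<in>I. {Y t -` B \<inter> space M | B. B \<in> sets borel})"
  unfolding generated_sigma_def by (rule sets_measure_of) auto

lemma space_generated_sigma [simp]: "space (generated_sigma M Y I) = space M"
  unfolding generated_sigma_def by (rule space_measure_of) auto

lemma filtration_natural_filtration: "filtration (space M) (natural_filtration M Y)"
  unfolding natural_filtration_def
proof
  show "sets (generated_sigma M Y {0..i}) \<subseteq> sets (generated_sigma M Y {0..j})"
    if "i \<le> j" for i j :: real
    unfolding sets_generated_sigma
    using that by (intro sigma_sets_mono' UN_mono) auto
qed simp

lemma subalgebra_natural_filtration:
  assumes "\<And>t. 0 \<le> t \<Longrightarrow> Y t \<in> borel_measurable M"
  shows "subalgebra M (natural_filtration M Y t)"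
  unfolding subalgebra_def natural_filtration_def sets_generated_sigma
  by (auto intro!: sets.sigma_sets_subset measurable_sets[OF assms])

end

theory Submission
  imports Defs
begin

text \<open>
  Write \<open>f\<close> for the density of \<open>X T\<close> and \<open>g = h \<circ> exp\<close>. The substitution \<open>z = ln x + y\<close> gives
  \<open>E h (x e\<^sup>X) = \<integral> f y h (x e\<^sup>y) dy = \<integral> g z f (z - ln x) dz\<close>,
  which moves the dependence on \<open>x\<close> from the merely measurable \<open>h\<close> to the smooth density. It
  remains to differentiate under the integral sign, that is, to dominate \<open>g z f' (z - u)\<close> locally
  uniformly in \<open>u\<close>.

  The domination comes from a single property of the Meixner density: its logarithmic derivative
  is bounded, \<open>\<bar>f'\<bar> \<le> K f\<close>. By Gronwall's inequality shifting the argument of \<open>f\<close> by \<open>s\<close> then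
  changes its value by a factor of at most \<open>exp (K \<bar>s\<bar>)\<close>, so for \<open>u\<close> near \<open>v\<close> everything is
  dominated by a multiple of \<open>\<bar>g z\<bar> f (z - v)\<close> (lemmas \<open>shift_le\<close>, \<open>increment_le\<close>,
  \<open>correlation_C1\<close>). The same factor shows that integrability of \<open>h (x e\<^sup>X)\<close> for one \<open>x > 0\<close>
  implies it for all \<open>x > 0\<close>.

  The logarithmic derivative of \<open>\<bar>\<Gamma> (d + i y)\<bar>\<^sup>2\<close> in \<open>y\<close> is \<open>- 2 Im \<psi> (d + i y)\<close> with the digamma
  function \<open>\<psi>\<close>, and \<open>Im \<psi> (d + i y)\<close> is the series of \<open>y / ((d + n)\<^sup>2 + y\<^sup>2)\<close> over \<open>n \<ge> 0\<close>. Comparison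
  with the integral of the Poisson kernel, whose total mass on a half line is \<open>\<pi> / 2\<close>, bounds it
  uniformly in \<open>y\<close> (lemma \<open>Im_Digamma_bound\<close>).

  A starting point \<open>x\<close> at which \<open>h (x e\<^sup>X)\<close> is integrable is provided by the hypothesis that
  \<open>h (S T)\<close> is integrable: \<open>S0\<close> is independent of \<open>X T\<close>, so by Fubini's theorem almost every
  value of \<open>S0\<close> qualifies (lemma \<open>AE_integrable_freeze\<close>).
\<close>

section \<open>Densities with bounded logarithmic derivative\<close>

locale bounded_log_derivative =
  fixes f f' :: "real \<Rightarrow> real" and K :: real
  assumes deriv: "\<And>x. (f has_real_derivative f' x) (at x)"
    and bound: "\<And>x. \<bar>f' x\<bar> \<le> K * f x"
    and continuous_deriv: "continuous_on UNIV f'"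
    and nonneg: "\<And>x. 0 \<le> f x"
    and K_nonneg: "0 \<le> K"
begin

lemma continuous: "continuous_on UNIV f"
  using deriv by (meson DERIV_isCont continuous_at_imp_continuous_on)

lemma measurable_f [measurable]: "f \<in> borel_measurable borel"
  using continuous by (rule borel_measurable_continuous_onI)

lemma measurable_deriv [measurable]: "f' \<in> borel_measurable borel"
  using continuous_deriv by (rule borel_measurable_continuous_onI)

text \<open>
  Gronwall's inequality: because \<open>\<bar>f'\<bar> \<le> K f\<close>, the function \<open>f y * exp (- K * y)\<close> is nonincreasing,
  which settles shifts to the right, and \<open>f y * exp (K * y)\<close> is nondecreasing, which settles shifts
  to the left.
\<close>

lemma shift_le: "f (x + s) \<le> exp (K * \<bar>s\<bar>) * f x"
proof (cases "0 \<le> s")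
  case True
  have "- (f x * exp (- K * x)) \<le> - (f (x + s) * exp (- K * (x + s)))"
  proof (rule DERIV_nonneg_imp_nondecreasing[where f = "\<lambda>y. - (f y * exp (- K * y))"])
    fix y
    have "((\<lambda>y. - (f y * exp (- K * y))) has_real_derivative
        (K * f y - f' y) * exp (- K * y)) (at y)"
      by (auto intro!: derivative_eq_intros deriv simp: algebra_simps)
    moreover have "(K * f y - f' y) * exp (- K * y) \<ge> 0"
      using bound[of y] by simp
    ultimately show "\<exists>d. ((\<lambda>y. - (f y * exp (- K * y))) has_real_derivative d) (at y) \<and> 0 \<le> d"
      by blast
  qed (use True in simp)
  hence "f (x + s) * exp (- K * (x + s)) * exp (K * (x + s)) \<le> f x * exp (- K * x) * exp (K * (x + s))"
    by (intro mult_right_mono) auto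
  with True show ?thesis
    by (simp add: mult.assoc exp_add[symmetric]) (simp add: algebra_simps)
next
  case False
  have "f (x + s) * exp (K * (x + s)) \<le> f x * exp (K * x)"
  proof (rule DERIV_nonneg_imp_nondecreasing[where f = "\<lambda>y. f y * exp (K * y)"])
    fix y
    have "((\<lambda>y. f y * exp (K * y)) has_real_derivative (K * f y + f' y) * exp (K * y)) (at y)"
      by (auto intro!: derivative_eq_intros deriv simp: algebra_simps)
    moreover have "(K * f y + f' y) * exp (K * y) \<ge> 0"
      using bound[of y] by simp
    ultimately show "\<exists>d. ((\<lambda>y. f y * exp (K * y)) has_real_derivative d) (at y) \<and> 0 \<le> d"
      by blast
  qed (use False in simp)
  hence "f (x + s) * exp (K * (x + s)) * exp (- K * (x + s)) \<le> f x * exp (K * x) * exp (- K * (x + s))"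
    by (intro mult_right_mono) auto
  with False show ?thesis
    by (simp add: mult.assoc exp_add[symmetric]) (simp add: algebra_simps)
qed

text \<open>
  By the mean value theorem, with \<open>f'\<close> at the intermediate point compared to \<open>f x\<close>. This is the
  domination of difference quotients: the bound involves \<open>f\<close> only at the base point \<open>x\<close>.
\<close>

lemma increment_le: "\<bar>f (x + s) - f x\<bar> \<le> K * exp (K * \<bar>s\<bar>) * f x * \<bar>s\<bar>"
proof -
  have "norm (f (x + s) - f x) \<le> (K * exp (K * \<bar>s\<bar>) * f x) * norm (x + s - x)"
  proof (rule field_differentiable_bound[where f' = f'])
    show "convex (closed_segment x (x + s))" by simp
    fix y assume y: "y \<in> closed_segment x (x + s)"
    hence "\<bar>y - x\<bar> \<le> \<bar>s\<bar>" by (auto simp: closed_segment_eq_real_ivl split: if_splits)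
    have "norm (f' y) \<le> K * f (x + (y - x))" using bound by simp
    also have "\<dots> \<le> K * (exp (K * \<bar>y - x\<bar>) * f x)"
      using shift_le[of x "y - x"] K_nonneg by (intro mult_left_mono)
    also have "\<dots> \<le> K * (exp (K * \<bar>s\<bar>) * f x)"
      using \<open>\<bar>y - x\<bar> \<le> \<bar>s\<bar>\<close> K_nonneg nonneg
      by (intro mult_left_mono mult_right_mono) (auto intro: mult_left_mono)
    finally show "norm (f' y) \<le> K * exp (K * \<bar>s\<bar>) * f x" by (simp add: mult.assoc)
    show "(f has_field_derivative f' y) (at y within closed_segment x (x + s))"
      using deriv by (rule has_field_derivative_at_within)
  qed auto
  thus ?thesis by simp
qed

text \<open>
  Two shifts of \<open>f\<close> are comparable up to a constant factor, so they have the same integrable weights.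
\<close>

lemma integrable_shift:
  assumes [measurable]: "g \<in> borel_measurable borel"
    and int: "integrable lborel (\<lambda>z. g z * f (z - u))"
  shows "integrable lborel (\<lambda>z. g z * f (z - v))"
proof (rule Bochner_Integration.integrable_bound)
  show "integrable lborel (\<lambda>z. exp (K * \<bar>u - v\<bar>) * (g z * f (z - u)))"
    using int by simp
  show "AE z in lborel. norm (g z * f (z - v)) \<le> norm (exp (K * \<bar>u - v\<bar>) * (g z * f (z - u)))"
  proof (rule AE_I2)
    fix z
    have "f (z - v) \<le> exp (K * \<bar>u - v\<bar>) * f (z - u)"
      using shift_le[of "z - u" "u - v"] by simp
    from mult_left_mono[OF this, of "\<bar>g z\<bar>"] nonneg
    show "norm (g z * f (z - v)) \<le> norm (exp (K * \<bar>u - v\<bar>) * (g z * f (z - u)))"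
      by (simp add: abs_mult mult_ac)
  qed
qed simp

text \<open>
  Dominated convergence along sequences \<open>v \<longlonglongrightarrow> u\<close>. Such a sequence stays within a bounded distance
  \<open>B\<close> of \<open>u\<close>, so both the difference quotients of \<open>f\<close> and the values of \<open>f'\<close> are at most
  \<open>K * exp (K * B) * f (z - u)\<close>.
\<close>

lemma correlation_C1:
  assumes [measurable]: "g \<in> borel_measurable borel"
    and int: "\<And>u. integrable lborel (\<lambda>z. g z * f (z - u))"
  shows "((\<lambda>u. LINT z|lborel. g z * f (z - u)) has_real_derivative
           - (LINT z|lborel. g z * f' (z - u))) (at u)"
    and "isCont (\<lambda>u. LINT z|lborel. g z * f' (z - u)) u"
proof -
  have dominated: "integrable lborel (\<lambda>z. K * exp (K * B) * \<bar>g z * f (z - u)\<bar>)" for B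
    using int by auto
  have bounded: "\<exists>B. \<forall>i. \<bar>v i - u\<bar> \<le> B" if "v \<longlonglongrightarrow> u" for v :: "nat \<Rightarrow> real"
  proof -
    have "Bseq (\<lambda>i. v i - u)"
      using that by (intro convergent_imp_Bseq convergentI[of _ 0]) (simp add: LIM_zero)
    thus ?thesis by (auto simp: Bseq_def)
  qed
  show "((\<lambda>u. LINT z|lborel. g z * f (z - u)) has_real_derivative
           - (LINT z|lborel. g z * f' (z - u))) (at u)"
    unfolding has_field_derivative_iff tendsto_at_iff_sequentially
  proof (intro allI impI)
    fix v :: "nat \<Rightarrow> real"
    assume ne: "\<forall>i. v i \<in> UNIV - {u}" and lim: "v \<longlonglongrightarrow> u"
    obtain B where B: "\<And>i. \<bar>v i - u\<bar> \<le> B" using bounded[OF lim] by blast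
    have "(\<lambda>i. LINT z|lborel. g z * ((f (z - v i) - f (z - u)) / (v i - u)))
            \<longlonglongrightarrow> (LINT z|lborel. g z * - f' (z - u))"
    proof (rule integral_dominated_convergence[OF _ _ dominated[of B]])
      show "AE z in lborel. (\<lambda>i. g z * ((f (z - v i) - f (z - u)) / (v i - u)))
              \<longlonglongrightarrow> g z * - f' (z - u)"
      proof (intro AE_I2 tendsto_mult_left)
        fix z
        have "((\<lambda>w. z - w) has_real_derivative - 1) (at u)"
          by (auto intro!: derivative_eq_intros)
        from DERIV_chain2[OF deriv this]
        have "((\<lambda>w. f (z - w)) has_real_derivative - f' (z - u)) (at u)"
          by simp
        thus "(\<lambda>i. (f (z - v i) - f (z - u)) / (v i - u)) \<longlonglongrightarrow> - f' (z - u)"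
          using ne lim
          unfolding has_field_derivative_iff tendsto_at_iff_sequentially comp_def by blast
      qed
      fix i
      show "AE z in lborel. norm (g z * ((f (z - v i) - f (z - u)) / (v i - u)))
              \<le> K * exp (K * B) * \<bar>g z * f (z - u)\<bar>"
      proof (rule AE_I2)
        fix z
        have "\<bar>f (z - v i) - f (z - u)\<bar>
                \<le> K * exp (K * \<bar>v i - u\<bar>) * f (z - u) * \<bar>v i - u\<bar>"
          using increment_le[of "z - u" "u - v i"] by (simp add: abs_minus_commute)
        hence "\<bar>f (z - v i) - f (z - u)\<bar> / \<bar>v i - u\<bar> \<le> K * exp (K * \<bar>v i - u\<bar>) * f (z - u)"
          using ne by (simp add: divide_le_eq)
        also have "\<dots> \<le> K * exp (K * B) * f (z - u)"
          using B[of i] K_nonneg nonneg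
          by (intro mult_right_mono mult_left_mono) (auto intro: mult_left_mono)
        finally show "norm (g z * ((f (z - v i) - f (z - u)) / (v i - u)))
              \<le> K * exp (K * B) * \<bar>g z * f (z - u)\<bar>"
          using nonneg mult_left_mono[of _ _ "\<bar>g z\<bar>"] by (fastforce simp: abs_mult mult_ac)
      qed
    qed simp_all
    moreover have "(LINT z|lborel. g z * ((f (z - v i) - f (z - u)) / (v i - u)))
        = ((LINT z|lborel. g z * f (z - v i)) - (LINT z|lborel. g z * f (z - u))) / (v i - u)" for i
      by (subst Bochner_Integration.integral_diff[symmetric, OF int int])
         (simp add: right_diff_distrib flip: integral_divide_zero)
    ultimately show "((\<lambda>y. ((LINT z|lborel. g z * f (z - y)) - (LINT z|lborel. g z * f (z - u)))
        / (y - u)) \<circ> v) \<longlonglongrightarrow> - (LINT z|lborel. g z * f' (z - u))"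
      using ne by (simp add: comp_def)
  qed
  show "isCont (\<lambda>u. LINT z|lborel. g z * f' (z - u)) u"
    unfolding continuous_at_sequentially
  proof (intro allI impI)
    fix v :: "nat \<Rightarrow> real"
    assume lim: "v \<longlonglongrightarrow> u"
    obtain B where B: "\<And>i. \<bar>v i - u\<bar> \<le> B" using bounded[OF lim] by blast
    have "(\<lambda>i. LINT z|lborel. g z * f' (z - v i)) \<longlonglongrightarrow> (LINT z|lborel. g z * f' (z - u))"
    proof (rule integral_dominated_convergence[OF _ _ dominated[of B]])
      show "AE z in lborel. (\<lambda>i. g z * f' (z - v i)) \<longlonglongrightarrow> g z * f' (z - u)"
        using lim
        by (intro AE_I2 tendsto_mult_left continuous_on_tendsto_compose[OF continuous_deriv])
           (auto intro: tendsto_intros)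
      fix i
      show "AE z in lborel. norm (g z * f' (z - v i)) \<le> K * exp (K * B) * \<bar>g z * f (z - u)\<bar>"
      proof (rule AE_I2)
        fix z
        have "\<bar>f' (z - v i)\<bar> \<le> K * f (z - v i)" by (rule bound)
        also have "\<dots> \<le> K * (exp (K * \<bar>v i - u\<bar>) * f (z - u))"
          using shift_le[of "z - u" "u - v i"] K_nonneg
          by (intro mult_left_mono) (auto simp: abs_minus_commute)
        also have "\<dots> \<le> K * (exp (K * B) * f (z - u))"
          using B[of i] K_nonneg nonneg
          by (intro mult_right_mono mult_left_mono) (auto intro: mult_left_mono)
        finally show "norm (g z * f' (z - v i)) \<le> K * exp (K * B) * \<bar>g z * f (z - u)\<bar>"
          using nonneg mult_left_mono[of _ _ "\<bar>g z\<bar>"] by (fastforce simp: abs_mult mult_ac)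
      qed
    qed simp_all
    thus "((\<lambda>u. LINT z|lborel. g z * f' (z - u)) \<circ> v) \<longlonglongrightarrow> (LINT z|lborel. g z * f' (z - u))"
      by (simp add: comp_def)
  qed
qed

text \<open>
  The correlation integral in the multiplicative coordinate: \<open>x * exp y = exp (ln x + y)\<close> turns
  scaling of the argument of \<open>h\<close> into a shift of \<open>f\<close>.
\<close>

lemma multiplicative_shift:
  assumes h: "(\<lambda>z. h (exp z)) \<in> borel_measurable borel"
    and x0: "x0 > 0" "integrable lborel (\<lambda>y. f y * h (x0 * exp y))"
  shows "\<forall>x>0. integrable lborel (\<lambda>y. f y * h (x * exp y))"
    and "(\<lambda>x. LINT y|lborel. f y * h (x * exp y)) C1_differentiable_on {0<..}"
proof -
  let ?F = "\<lambda>u. LINT z|lborel. h (exp z) * f (z - u)"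
  let ?D = "\<lambda>u. LINT z|lborel. h (exp z) * f' (z - u)"
  (* the redundant factor 1 matches the affine substitution rules for lborel *)
  have shift: "(\<lambda>y. f y * h (x * exp y)) = (\<lambda>y. h (exp (ln x + 1 * y)) * f ((ln x + 1 * y) - ln x))"
    if "x > 0" for x
    using that by (simp add: exp_add mult_ac)
  have "integrable lborel (\<lambda>z. h (exp z) * f (z - ln x0))"
    using x0(2) unfolding shift[OF x0(1)]
    by (subst (asm) lborel_integrable_real_affine_iff[where f = "\<lambda>z. h (exp z) * f (z - ln x0)"]) auto
  hence int: "integrable lborel (\<lambda>z. h (exp z) * f (z - u))" for u
    by (rule integrable_shift[OF h])
  show "\<forall>x>0. integrable lborel (\<lambda>y. f y * h (x * exp y))"
  proof (intro allI impI)
    fix x :: real assume "x > 0"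
    show "integrable lborel (\<lambda>y. f y * h (x * exp y))"
      unfolding shift[OF \<open>x > 0\<close>]
      using lborel_integrable_real_affine[OF int[of "ln x"], of 1 "ln x"] by simp
  qed
  have eq: "(LINT y|lborel. f y * h (x * exp y)) = ?F (ln x)" if "x > 0" for x
    using lborel_integral_real_affine[of 1 "\<lambda>z. h (exp z) * f (z - ln x)" "ln x"]
    unfolding shift[OF that] by simp
  show "(\<lambda>x. LINT y|lborel. f y * h (x * exp y)) C1_differentiable_on {0<..}"
    unfolding C1_differentiable_on_def
  proof (intro exI conjI ballI)
    fix x :: real assume x: "x \<in> {0<..}"
    have "((\<lambda>x. ?F (ln x)) has_real_derivative - ?D (ln x) * (1 / x)) (at x)"
      using x by (intro DERIV_chain2[OF correlation_C1(1)[OF h int]])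
                 (auto intro!: derivative_eq_intros)
    hence "((\<lambda>x. LINT y|lborel. f y * h (x * exp y)) has_real_derivative
             - ?D (ln x) * (1 / x)) (at x)"
      by (rule has_field_derivative_transform_within_open[where S = "{0<..}"]) (use x eq in auto)
    thus "((\<lambda>x. LINT y|lborel. f y * h (x * exp y)) has_vector_derivative
             - ?D (ln x) * (1 / x)) (at x)"
      by (simp add: has_real_derivative_iff_has_vector_derivative)
  next
    have "continuous_on UNIV ?D"
      using correlation_C1(2)[OF h int] by (auto intro: continuous_at_imp_continuous_on)
    hence "continuous_on {0<..} (\<lambda>x. ?D (ln x))"
      by (rule continuous_on_compose2) (auto intro!: continuous_intros)
    thus "continuous_on {0<..} (\<lambda>x. - ?D (ln x) * (1 / x))"
      by (auto intro!: continuous_intros)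
  qed
qed

end

section \<open>The logarithmic derivative of the Meixner density\<close>

text \<open>
  The summand is the derivative of \<open>x \<mapsto> arctan (x / t)\<close> at \<open>d + n\<close> and decreases in \<open>n\<close>; hence the
  terms with \<open>n \<ge> 1\<close> are bounded by a telescoping sum of arctangents, uniformly in \<open>t\<close>.
  The term \<open>n = 0\<close> has no predecessor to compare with and is bounded by \<open>1 / (2 * d)\<close>
  because \<open>2 * d * t \<le> d\<^sup>2 + t\<^sup>2\<close>.
\<close>

lemma sum_Poisson_kernel_le:
  assumes "d > 0" "t > 0"
  shows "(\<Sum>n<m. t / ((d + real n)\<^sup>2 + t\<^sup>2)) \<le> 1 / (2 * d) + pi / 2"
proof -
  have step: "t / ((a + 1)\<^sup>2 + t\<^sup>2) \<le> arctan ((a + 1) / t) - arctan (a / t)" if "a > 0" for a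
  proof -
    have "\<exists>z>a. z < a + 1 \<and> arctan ((a + 1) / t) - arctan (a / t)
            = (a + 1 - a) * (t / (z\<^sup>2 + t\<^sup>2))"
    proof (rule MVT2)
      fix x
      have "((\<lambda>x. arctan (x / t)) has_real_derivative 1 / t * inverse (1 + (x / t)\<^sup>2)) (at x)"
        using assms by (auto intro!: derivative_eq_intros)
      also have "1 / t * inverse (1 + (x / t)\<^sup>2) = t / (x\<^sup>2 + t\<^sup>2)"
        using assms by (simp add: field_simps power2_eq_square add_pos_nonneg)
      finally show "((\<lambda>x. arctan (x / t)) has_real_derivative t / (x\<^sup>2 + t\<^sup>2)) (at x)" .
    qed simp
    then obtain z where z: "a < z" "z < a + 1"
      "arctan ((a + 1) / t) - arctan (a / t) = t / (z\<^sup>2 + t\<^sup>2)" by auto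
    have "z\<^sup>2 + t\<^sup>2 \<le> (a + 1)\<^sup>2 + t\<^sup>2" using z that by (simp add: power_mono)
    thus ?thesis unfolding z using assms by (intro divide_left_mono) (auto simp: sum_power2_gt_zero_iff)
  qed
  have telescope: "(\<Sum>n<Suc m. t / ((d + real n)\<^sup>2 + t\<^sup>2))
      \<le> 1 / (2 * d) + (arctan ((d + real m) / t) - arctan (d / t))" for m
  proof (induction m)
    case 0
    have "0 \<le> (d - t)\<^sup>2" by simp
    hence "t * (2 * d) \<le> d\<^sup>2 + t\<^sup>2" by (simp add: power2_eq_square algebra_simps)
    thus ?case using assms by (simp add: field_simps sum_power2_gt_zero_iff)
  next
    case (Suc m)
    thus ?case using step[of "d + real m"] assms by (simp add: add_ac)
  qed
  have "(\<Sum>n<m. t / ((d + real n)\<^sup>2 + t\<^sup>2)) \<le> (\<Sum>n<Suc m. t / ((d + real n)\<^sup>2 + t\<^sup>2))"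
    using assms by simp
  also have "\<dots> \<le> 1 / (2 * d) + pi / 2"
  proof -
    have "arctan (d / t) > 0" using assms by simp
    thus ?thesis using telescope[of m] arctan_ubound[of "(d + real m) / t"] by linarith
  qed
  finally show ?thesis .
qed

text \<open>
  In the limit formula for the digamma function the divergent logarithm is real. The imaginary
  parts of the approximants are therefore plain sums of Poisson kernels. That the bound does not
  depend on \<open>y\<close> is what makes the logarithmic derivative of the Meixner density bounded on the
  whole line.
\<close>

lemma Im_Digamma_bound:
  assumes "d > 0"
  shows "\<bar>Im (Digamma (Complex d y))\<bar> \<le> 1 / (2 * d) + pi / 2"
proof -
  have "(\<lambda>m. of_real (ln (real m)) - (\<Sum>n<m. inverse (Complex d y + of_nat n)))
          \<longlonglongrightarrow> Digamma (Complex d y)"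
    using assms by (intro Digamma_LIMSEQ) (auto simp: complex_eq_iff)
  hence lim: "(\<lambda>m. \<bar>Im (of_real (ln (real m)) - (\<Sum>n<m. inverse (Complex d y + of_nat n)))\<bar>)
          \<longlonglongrightarrow> \<bar>Im (Digamma (Complex d y))\<bar>"
    by (intro tendsto_rabs tendsto_Im)
  have "\<bar>Im (of_real (ln (real m)) - (\<Sum>n<m. inverse (Complex d y + of_nat n)))\<bar>
          \<le> 1 / (2 * d) + pi / 2" for m
  proof (cases "y = 0")
    case True
    thus ?thesis using assms by (simp add: Im_sum)
  next
    case False
    have "\<bar>Im (of_real (ln (real m)) - (\<Sum>n<m. inverse (Complex d y + of_nat n)))\<bar>
        = \<bar>\<Sum>n<m. y / ((d + real n)\<^sup>2 + y\<^sup>2)\<bar>"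
      by (simp add: Im_sum sum_negf)
    also have "\<dots> \<le> (\<Sum>n<m. \<bar>y / ((d + real n)\<^sup>2 + y\<^sup>2)\<bar>)" by (rule sum_abs)
    also have "\<dots> = (\<Sum>n<m. \<bar>y\<bar> / ((d + real n)\<^sup>2 + \<bar>y\<bar>\<^sup>2))" by (simp add: abs_divide)
    also have "\<dots> \<le> 1 / (2 * d) + pi / 2" using assms False by (intro sum_Poisson_kernel_le) auto
    finally show ?thesis .
  qed
  thus ?thesis by (intro LIMSEQ_le_const2[OF lim]) auto
qed

lemma meixner_density_nonneg:
  assumes "\<alpha> > 0" "\<delta> > 0"
  shows "0 \<le> meixner_density \<alpha> \<beta> \<mu> \<delta> x"
  using assms Gamma_real_pos[of "2 * \<delta>"] unfolding meixner_density_def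
  by (intro mult_nonneg_nonneg divide_nonneg_pos) auto

text \<open>
  The exponential factor contributes \<open>\<beta> / \<alpha>\<close> to the logarithmic derivative and the gamma
  factor contributes \<open>- 2 / \<alpha> * Im (Digamma z)\<close>, which is bounded.
\<close>

lemma meixner_bounded_log_derivative:
  assumes "\<alpha> > 0" "\<delta> > 0"
  obtains f' K where "bounded_log_derivative (meixner_density \<alpha> \<beta> \<mu> \<delta>) f' K"
proof
  define z where "z x = complex_of_real \<delta> + \<i> * complex_of_real ((x - \<mu>) / \<alpha>)" for x
  define L where "L x = \<beta> / \<alpha> - 2 / \<alpha> * Im (Digamma (z x))" for x
  define C where "C = (2 * cos (\<beta> / 2)) powr (2 * \<delta>) / (2 * pi * \<alpha> * Gamma (2 * \<delta>))"
  define K where "K = \<bar>\<beta> / \<alpha>\<bar> + 2 / \<alpha> * (1 / (2 * \<delta>) + pi / 2)"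
  let ?f = "meixner_density \<alpha> \<beta> \<mu> \<delta>"
  have f: "?f x = C * exp (\<beta> / \<alpha> * (x - \<mu>)) * (cmod (Gamma (z x)))\<^sup>2" for x
    by (simp add: meixner_density_def C_def z_def)
  have z: "z x \<notin> \<int>\<^sub>\<le>\<^sub>0" for x
    using assms by (auto simp: z_def complex_eq_iff elim!: nonpos_Ints_cases)
  have z_Complex: "z x = Complex \<delta> ((x - \<mu>) / \<alpha>)" for x
    by (simp add: z_def complex_eq_iff)
  have z_deriv: "(z has_vector_derivative \<i> / complex_of_real \<alpha>) (at x)" for x
    unfolding z_def using assms
    by (auto intro!: derivative_eq_intros simp: has_vector_derivative_def scaleR_conv_of_real field_simps)
  have deriv: "(?f has_real_derivative L x * ?f x) (at x)" for x
  proof -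
    have "(Gamma \<circ> z has_vector_derivative \<i> / complex_of_real \<alpha> * (Gamma (z x) * Digamma (z x))) (at x)"
      by (intro field_vector_diff_chain_at z_deriv has_field_derivative_Gamma z)
    hence "((\<lambda>x. Gamma (z x)) has_derivative
        (\<lambda>h. h *\<^sub>R (\<i> / complex_of_real \<alpha> * (Gamma (z x) * Digamma (z x))))) (at x)"
      by (simp add: comp_def has_vector_derivative_def)
    (* the squared modulus is the inner product of Gamma with itself, differentiable as a real
       bilinear form although the modulus is not holomorphic *)
    from has_derivative_inner[OF this this]
    have "((\<lambda>x. (cmod (Gamma (z x)))\<^sup>2) has_real_derivative
        2 * (Gamma (z x) \<bullet> (\<i> / complex_of_real \<alpha> * (Gamma (z x) * Digamma (z x))))) (at x)"
      by (simp add: has_field_derivative_def power2_norm_eq_inner inner_commute mult_ac mult_commute_abs)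
    also have "2 * (Gamma (z x) \<bullet> (\<i> / complex_of_real \<alpha> * (Gamma (z x) * Digamma (z x))))
        = - (2 / \<alpha> * Im (Digamma (z x))) * (cmod (Gamma (z x)))\<^sup>2"
      using assms unfolding cmod_power2
      by (simp add: inner_complex_def field_simps power2_eq_square)
    finally have "((\<lambda>x. (cmod (Gamma (z x)))\<^sup>2) has_real_derivative
        - (2 / \<alpha> * Im (Digamma (z x))) * (cmod (Gamma (z x)))\<^sup>2) (at x)" .
    moreover have "((\<lambda>x. C * exp (\<beta> / \<alpha> * (x - \<mu>))) has_real_derivative
        \<beta> / \<alpha> * (C * exp (\<beta> / \<alpha> * (x - \<mu>)))) (at x)"
      using assms by (auto intro!: derivative_eq_intros)
    ultimately show ?thesis unfolding f L_def
      by (auto dest: DERIV_mult simp: algebra_simps)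
  qed
  have "continuous_on UNIV z" unfolding z_def by (intro continuous_intros)  (use assms in auto)
  hence "continuous_on UNIV (\<lambda>x. Digamma (z x))"
    using z by (intro continuous_on_compose2[OF continuous_on_Polygamma[of "range z"]]) auto
  hence cont_L: "continuous_on UNIV L" unfolding L_def by (intro continuous_intros)
  have cont_f: "continuous_on UNIV ?f"
    using deriv by (meson DERIV_isCont continuous_at_imp_continuous_on)
  have L_bound: "\<bar>L x\<bar> \<le> K" for x
  proof -
    have "\<bar>L x\<bar> \<le> \<bar>\<beta> / \<alpha>\<bar> + \<bar>2 / \<alpha> * Im (Digamma (z x))\<bar>"
      unfolding L_def by (rule abs_triangle_ineq4)
    also have "\<bar>2 / \<alpha> * Im (Digamma (z x))\<bar> = 2 / \<alpha> * \<bar>Im (Digamma (z x))\<bar>"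
      using assms by (simp add: abs_mult)
    also have "\<dots> \<le> 2 / \<alpha> * (1 / (2 * \<delta>) + pi / 2)"
      unfolding z_Complex using assms by (intro mult_left_mono Im_Digamma_bound) auto
    finally show ?thesis by (simp add: K_def)
  qed
  show "bounded_log_derivative ?f (\<lambda>x. L x * ?f x) K"
  proof
    show "\<bar>L x * ?f x\<bar> \<le> K * ?f x" for x
      using L_bound[of x] meixner_density_nonneg[OF assms, of \<beta> \<mu> x]
      by (simp add: abs_mult mult_right_mono)
    show "0 \<le> K" using L_bound[of 0] by simp
    show "continuous_on UNIV (\<lambda>x. L x * ?f x)"
      using cont_L cont_f by (rule continuous_on_mult)
  qed (use deriv meixner_density_nonneg[OF assms] in auto)
qed

section \<open>Freezing an independent initial value\<close>

lemma (in prob_space) indep_var_of_indep_sigma: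
  assumes "indep_set (sets (vimage_algebra (space M) S0 borel)) (sets (generated_sigma M X I))"
    and "S0 \<in> borel_measurable M" "X T \<in> borel_measurable M" "T \<in> I"
  shows "indep_var borel S0 borel (X T)"
  unfolding indep_var_eq
proof (intro conjI assms)
  have "sigma_sets (space M) {X T -` A \<inter> space M |A. A \<in> sets borel} \<subseteq> sets (generated_sigma M X I)"
    unfolding sets_generated_sigma using \<open>T \<in> I\<close> by (intro sigma_sets_mono') auto
  thus "indep_set (sigma_sets (space M) {S0 -` A \<inter> space M |A. A \<in> sets borel})
      (sigma_sets (space M) {X T -` A \<inter> space M |A. A \<in> sets borel})"
    using assms(1) unfolding sets_vimage_algebra indep_set_def
    by (elim indep_sets_mono_sets) (auto split: bool.split)
qed

text \<open>
  By independence the joint law of \<open>Y\<close> and \<open>Z\<close> is the product of their laws, and almost all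
  sections of a function integrable for a product measure are integrable.
\<close>

lemma (in prob_space) AE_integrable_freeze:
  fixes \<phi> :: "'b \<Rightarrow> 'b \<Rightarrow> real"
  assumes indep: "indep_var N1 Y N2 Z"
    and \<phi>: "case_prod \<phi> \<in> borel_measurable (N1 \<Otimes>\<^sub>M N2)"
    and int: "integrable M (\<lambda>\<omega>. \<phi> (Y \<omega>) (Z \<omega>))"
  shows "AE \<omega>' in M. integrable M (\<lambda>\<omega>. \<phi> (Y \<omega>') (Z \<omega>))"
proof -
  from indep have [measurable]: "Y \<in> measurable M N1" "Z \<in> measurable M N2"
    and joint: "distr M N1 Y \<Otimes>\<^sub>M distr M N2 Z = distr M (N1 \<Otimes>\<^sub>M N2) (\<lambda>\<omega>. (Y \<omega>, Z \<omega>))"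
    by (auto simp: indep_var_distribution_eq)
  interpret Y: prob_space "distr M N1 Y" by (rule prob_space_distr) simp
  interpret Z: prob_space "distr M N2 Z" by (rule prob_space_distr) simp
  interpret YZ: pair_prob_space "distr M N1 Y" "distr M N2 Z" ..
  have "integrable (distr M N1 Y \<Otimes>\<^sub>M distr M N2 Z) (case_prod \<phi>)"
    unfolding joint using int \<phi> by (subst integrable_distr_eq) auto
  from YZ.AE_integrable_fst[OF this]
  have "AE y in distr M N1 Y. integrable (distr M N2 Z) (\<phi> y)" by simp
  hence "AE \<omega>' in M. integrable (distr M N2 Z) (\<phi> (Y \<omega>'))"
    by (rule AE_distrD[rotated]) simp
  thus ?thesis
  proof (rule AE_mp, intro AE_I2 impI)
    fix \<omega>' assume "integrable (distr M N2 Z) (\<phi> (Y \<omega>'))"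
    thus "integrable M (\<lambda>\<omega>. \<phi> (Y \<omega>') (Z \<omega>))"
      by (rule integrable_distr[OF \<open>Z \<in> measurable M N2\<close>])
  qed
qed

theorem proposition3:
  fixes M :: "'a measure"
    and X S :: "real \<Rightarrow> 'a \<Rightarrow> real"
    and S0 :: "'a \<Rightarrow> real"
    and h :: "real \<Rightarrow> real"
  assumes "meixner_process M X"
    and "S0 \<in> borel_measurable M"
    and "\<And>\<omega>. \<omega> \<in> space M \<Longrightarrow> S0 \<omega> > 0"
    and "prob_space.indep_set M
           (sets (vimage_algebra (space M) S0 borel)) (sets (generated_sigma M X {0..}))"
    and "\<And>t \<omega>. S t \<omega> = S0 \<omega> * exp (X t \<omega>)"
    and "martingale M (natural_filtration M S) S"
    and "\<And>t. t \<ge> 0 \<Longrightarrow> \<exists>p>1. \<exists>p'>0.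
           integrable M (\<lambda>\<omega>. S t \<omega> powr p) \<and> integrable M (\<lambda>\<omega>. S t \<omega> powr (- p'))"
    and "h \<in> borel_measurable (restrict_space borel {0<..})"
    and "\<exists>c>0. \<forall>x>0. \<bar>h x\<bar> \<le> c * (1 + x)"
    and "\<And>T. T > 0 \<Longrightarrow> integrable M (\<lambda>\<omega>. h (S T \<omega>))"
  shows "\<forall>T>0. (\<forall>x>0. integrable M (\<lambda>\<omega>. h (x * exp (X T \<omega>)))) \<and>
           (\<lambda>x. prob_space.expectation M (\<lambda>\<omega>. h (x * exp (X T \<omega>)))) C1_differentiable_on {0<..}"
proof (intro allI impI)
  fix T :: real assume T: "T > 0"
  from assms(1) obtain \<alpha> \<beta> \<mu> \<delta> where levy: "levy_process M X"
    and par: "\<alpha> > 0" "\<delta> > 0"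
    and dist: "\<And>t. t > 0 \<Longrightarrow> distributed M lborel (X t)
                 (\<lambda>x. ennreal (meixner_density \<alpha> \<beta> (\<mu> * t) (\<delta> * t) x))"
    unfolding meixner_process_def by blast
  interpret levy_process M X by (rule levy)
  let ?f = "meixner_density \<alpha> \<beta> (\<mu> * T) (\<delta> * T)"
  obtain f' K where "bounded_log_derivative ?f f' K"
    using par T by (rule_tac meixner_bounded_log_derivative[of \<alpha> "\<delta> * T"]) auto
  then interpret bounded_log_derivative ?f f' K .
  have X [measurable]: "X T \<in> borel_measurable M" using measurable_X T by simp
  note [measurable] = assms(2)
  (* h carries no measurability information outside {0<..}; k is its measurable extension by 0 *)
  define k where "k s = (if s > 0 then h s else 0)" for s
  have "(\<lambda>s. indicator {0<..} s *\<^sub>R h s) \<in> borel_measurable borel"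
    using assms(8) by (subst (asm) borel_measurable_restrict_space_iff) auto
  also have "(\<lambda>s. indicator {0<..} s *\<^sub>R h s) = k"
    by (auto simp: k_def fun_eq_iff)
  finally have k [measurable]: "k \<in> borel_measurable borel" .
  have hk: "h (x * exp y) = k (x * exp y)" if "x > 0" for x y using that by (simp add: k_def)

  (* a deterministic initial value is found among the values of S0 *)
  have "indep_var borel S0 borel (X T)"
    using T by (intro indep_var_of_indep_sigma[OF assms(4)]) auto
  moreover have "integrable M (\<lambda>\<omega>. k (S0 \<omega> * exp (X T \<omega>)))"
    using assms(10)[OF T] assms(3)
    by (subst Bochner_Integration.integrable_cong[OF refl, of _ _ "\<lambda>\<omega>. h (S T \<omega>)"])
       (auto simp: assms(5) hk)
  ultimately have "AE \<omega>' in M. integrable M (\<lambda>\<omega>. k (S0 \<omega>' * exp (X T \<omega>)))"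
    by (intro AE_integrable_freeze[where \<phi> = "\<lambda>s x. k (s * exp x)"]) auto
  hence "AE \<omega>' in M. S0 \<omega>' > 0 \<and> integrable M (\<lambda>\<omega>. k (S0 \<omega>' * exp (X T \<omega>)))"
    using assms(3) by (auto elim: AE_mp)
  hence "\<exists>\<omega>'. S0 \<omega>' > 0 \<and> integrable M (\<lambda>\<omega>. k (S0 \<omega>' * exp (X T \<omega>)))"
    by (intro eventually_happens'[OF ae_filter_bot])
  then obtain x0 where x0: "x0 > 0" "integrable M (\<lambda>\<omega>. k (x0 * exp (X T \<omega>)))"
    by blast

  have density_integrable: "integrable lborel (\<lambda>y. ?f y * k (x * exp y))
      \<longleftrightarrow> integrable M (\<lambda>\<omega>. k (x * exp (X T \<omega>)))" for x
    by (rule distributed_integrable[OF dist[OF T]]) (auto simp: nonneg)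
  have density_expectation: "(LINT y|lborel. ?f y * k (x * exp y))
      = expectation (\<lambda>\<omega>. k (x * exp (X T \<omega>)))" for x
    by (rule distributed_integral[OF dist[OF T]]) (auto simp: nonneg)
  have k_exp: "(\<lambda>z. k (exp z)) \<in> borel_measurable borel" by measurable
  note smooth = multiplicative_shift[OF k_exp x0(1), unfolded density_integrable
      density_expectation, OF x0(2)]
  have "(\<lambda>x. expectation (\<lambda>\<omega>. h (x * exp (X T \<omega>)))) C1_differentiable_on {0<..}"
  proof -
    obtain D where D: "\<And>x. x \<in> {0<..} \<Longrightarrow>
        ((\<lambda>x. expectation (\<lambda>\<omega>. k (x * exp (X T \<omega>)))) has_vector_derivative D x) (at x)"
      and cont: "continuous_on {0<..} D"
      using smooth(2) unfolding C1_differentiable_on_def by blast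
    have "((\<lambda>x. expectation (\<lambda>\<omega>. h (x * exp (X T \<omega>)))) has_vector_derivative D x) (at x)"
      if "x \<in> {0<..}" for x
      using D[OF that]
      by (rule has_vector_derivative_transform_within_open[where S = "{0<..}"])
         (use that in \<open>auto simp: hk\<close>)
    with cont show ?thesis unfolding C1_differentiable_on_def by blast
  qed
  thus "(\<forall>x>0. integrable M (\<lambda>\<omega>. h (x * exp (X T \<omega>)))) \<and>
      (\<lambda>x. expectation (\<lambda>\<omega>. h (x * exp (X T \<omega>)))) C1_differentiable_on {0<..}"
    using smooth(1) by (simp add: hk)
qed

end
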